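(* Let $\psi_1,\dots,\psi_m:\mathbb{R}^n\to\mathbb{R}^n$ be similitudes with ratios $r_1,\dots,r_m\in(0,1)$ satisfying the open set condition, let $(\mathcal{N}_k)_{k\ge 1}$ be a sequence of non-empty subsets of $\{1,\dots,m\}$, and let $E$ be the associated statistically self-similar set. Let $s\ge 0$ be the unique number such that, for $t\ge 0$, $$\liminf_{k\to\infty}\sum_{(j_1,\dots,j_k)\in\mathcal{L}^k}(r_{j_1}\cdots r_{j_k})^t=\begin{cases}\infty, & t<s,\\ 0, & t>s.\end{cases}$$ Then the Hausdorff dimension of $E$ is $\dim(E)=s$.
   Context: A map $\psi:\mathbb{R}^n\to\mathbb{R}^n$ is a similitude with ratio $r$, where $0<r<1$, if $|\psi(x)-\psi(y)|=r|x-y|$ for all $x,y\in\mathbb{R}^n$. For $k\ge1$ put $\mathcal{L}^k=\prod_{i=1}^k\mathcal{N}_i$. Let $\Gamma$ be the collection of all non-empty compact subsets of $\mathbb{R}^n$ with the Hausdorff metric $d$, and for $F\in\Gamma$ put $$\psi^k(F)=\bigcup_{(j_1,\dots,j_k)\in\mathcal{L}^k}(\psi_{j_1}\circ\cdots\circ\psi_{j_k})(F).$$ There is a unique $E\in\Gamma$ such that $d(\psi^k(F),E)\to0$ as $k\to\infty$ for every $F\in\Gamma$. The family $\{\psi_j\}_{j=1}^m$ satisfies the open set condition if there is a non-empty bounded open set $V\subset\mathbb{R}^n$ such that $\psi_j(V)\subset V$ for all $j$ and $\psi_j(V)\cap\psi_i(V)=\emptyset$ for all $i\ne j$ in $\{1,\dots,m\}$.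 When the open set condition holds, the set $E$ above is called the statistically self-similar set associated with $(\psi_j)_{j=1}^m$ and $(\mathcal{N}_k)_{k\ge1}$. It is known that for any such data a unique $s\ge0$ with the property displayed in the claim exists. $\dim$ denotes Hausdorff dimension. *)

theory Defs
  imports "HOL-Analysis.Analysis"
begin

subsection \<open>Hausdorff measure and Hausdorff dimension\<close>

text \<open>
  The \<open>t\<close>-th power of the diameter. With \<open>powr\<close> we have \<open>0 powr 0 = 0\<close>, so the exponent
  \<open>t = 0\<close> is treated separately: every non-empty set then gets weight 1, which makes the
  0-dimensional Hausdorff measure the counting measure. The empty set always has weight 0.
\<close>
definition diameter_pow :: "real \<Rightarrow> 'a::metric_space set \<Rightarrow> ennreal" where
  "diameter_pow t U =
     (if U = {} then 0 else if t = 0 then 1 else ennreal (diameter U powr t))"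

text \<open>
  Covers are countable families indexed by \<^typ>\<open>nat\<close>; finite covers are padded with the empty
  set. Boundedness is required explicitly because \<^const>\<open>diameter\<close> has an
  unspecified real value on unbounded sets.
\<close>
definition hausdorff_premeasure :: "real \<Rightarrow> real \<Rightarrow> 'a::metric_space set \<Rightarrow> ennreal" where
  "hausdorff_premeasure t \<delta> A =
     (INF U \<in> {U :: nat \<Rightarrow> 'a set. A \<subseteq> (\<Union>i. U i) \<and> (\<forall>i. bounded (U i) \<and> diameter (U i) \<le> \<delta>)}.
        \<Sum>i. diameter_pow t (U i))"

definition hausdorff_measure :: "real \<Rightarrow> 'a::metric_space set \<Rightarrow> ennreal" where
  "hausdorff_measure t A = (SUP \<delta>\<in>{0<..}. hausdorff_premeasure t \<delta> A)"

definition hausdorff_dimension :: "'a::metric_space set \<Rightarrow> ereal" where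
  "hausdorff_dimension A = (INF t\<in>{t. 0 \<le> t \<and> hausdorff_measure t A = 0}. ereal t)"

subsection \<open>The Hausdorff metric\<close>

text \<open>Only meaningful for non-empty bounded sets, where both suprema are finite.\<close>
definition hausdorff_distance :: "'a::metric_space set \<Rightarrow> 'a set \<Rightarrow> real" where
  "hausdorff_distance A B = max (SUP x\<in>A. infdist x B) (SUP y\<in>B. infdist y A)"

subsection \<open>Statistically self-similar sets\<close>

definition similitude :: "('a::metric_space \<Rightarrow> 'a) \<Rightarrow> real \<Rightarrow> bool" where
  "similitude f \<rho> \<longleftrightarrow> 0 < \<rho> \<and> \<rho> < 1 \<and> (\<forall>x y. dist (f x) (f y) = \<rho> * dist x y)"

definition open_set_condition :: "nat \<Rightarrow> (nat \<Rightarrow> 'a::metric_space \<Rightarrow> 'a) \<Rightarrow> bool" where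
  "open_set_condition m \<psi> \<longleftrightarrow>
     (\<exists>V. V \<noteq> {} \<and> bounded V \<and> open V \<and>
          (\<forall>j\<in>{1..m}. \<psi> j ` V \<subseteq> V) \<and>
          (\<forall>i\<in>{1..m}. \<forall>j\<in>{1..m}. i \<noteq> j \<longrightarrow> \<psi> j ` V \<inter> \<psi> i ` V = {}))"

text \<open>
  \<open>words N k\<close> is \<open>N 1 \<times> \<dots> \<times> N k\<close>, its elements \<open>(j\<^sub>1, \<dots>, j\<^sub>k)\<close> being represented as lists
  \<open>[j\<^sub>1, \<dots>, j\<^sub>k]\<close>. The value \<open>N 0\<close> is never used.
\<close>
definition words :: "(nat \<Rightarrow> nat set) \<Rightarrow> nat \<Rightarrow> nat list set" where
  "words N k = listset (map N [1..<Suc k])"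

text \<open>\<open>compose_word \<psi> [j\<^sub>1, \<dots>, j\<^sub>k] = \<psi> j\<^sub>1 \<circ> \<dots> \<circ> \<psi> j\<^sub>k\<close>\<close>
definition compose_word :: "(nat \<Rightarrow> 'a \<Rightarrow> 'a) \<Rightarrow> nat list \<Rightarrow> 'a \<Rightarrow> 'a" where
  "compose_word \<psi> js = foldr (\<circ>) (map \<psi> js) id"

definition iterate_image ::
    "(nat \<Rightarrow> 'a \<Rightarrow> 'a) \<Rightarrow> (nat \<Rightarrow> nat set) \<Rightarrow> nat \<Rightarrow> 'a set \<Rightarrow> 'a set" where
  "iterate_image \<psi> N k F = (\<Union>js\<in>words N k. compose_word \<psi> js ` F)"

text \<open>
  The property that determines the statistically self-similar set associated with \<open>\<psi>\<close> and \<open>N\<close>;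
  the open set condition is a separate assumption.
\<close>
definition statistically_self_similar_set ::
    "(nat \<Rightarrow> 'a::metric_space \<Rightarrow> 'a) \<Rightarrow> (nat \<Rightarrow> nat set) \<Rightarrow> 'a set \<Rightarrow> bool" where
  "statistically_self_similar_set \<psi> N E \<longleftrightarrow>
     E \<noteq> {} \<and> compact E \<and>
     (\<forall>F. F \<noteq> {} \<and> compact F \<longrightarrow>
        (\<lambda>k. hausdorff_distance (iterate_image \<psi> N k F) E) \<longlonglongrightarrow> 0)"

end

theory Submission
  imports Defs "HOL-Library.Sublist"
begin

text \<open>
  Let \<open>V\<close> be the open set of the open set condition and \<open>K = closure V\<close>. Every map sends \<open>K\<close> into
  itself, so the approximations \<open>\<psi>\<^sup>k(K)\<close> decrease; hence \<open>E\<close> lies in each of them, and conversely they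
  lie in any given neighbourhood of \<open>E\<close> for large \<open>k\<close>. Write \<open>M\<^sub>k(t)\<close> for the sum of the \<open>t\<close>-th powers
  of the ratios over the words of length \<open>k\<close>; it is called \<open>mass\<close> below.

  For \<open>t > s\<close> the images of \<open>K\<close> under the words of length \<open>k\<close> cover \<open>E\<close>, their diameters tend to 0
  uniformly, and the sum of the \<open>t\<close>-th powers of these diameters is at most a constant times \<open>M\<^sub>k(t)\<close>,
  which is arbitrarily small for infinitely many \<open>k\<close>. So the \<open>t\<close>-dimensional measure of \<open>E\<close> vanishes
  (\<open>hausdorff_measure_zero_if_mass_small\<close>).

  For \<open>t < s\<close> the numbers \<open>M\<^sub>k(t)\<close> tend to infinity and are positive, so they are bounded below by some
  \<open>c > 0\<close>. This calls for the mass distribution principle, applied to the product measure that gives a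
  cylinder \<open>p\<close> of length \<open>l\<close> the mass \<open>r\<^sub>p\<^sup>t / M\<^sub>l(t) \<le> r\<^sub>p\<^sup>t / c\<close>. No measure is actually constructed:
  since \<open>E\<close> is compact, a cover of \<open>E\<close> can be replaced by finitely many open balls, these cover
  \<open>\<psi>\<^sup>k(K)\<close> for some large \<open>k\<close>, and the normalised weights of the words of length \<open>k\<close> serve as the
  measure. It remains to bound the weight of the words that send a fixed point of \<open>V\<close> into
  a given ball of radius \<open>\<rho>\<close> (\<open>ball_mass_bound\<close>). Cut each of them off as soon as its ratio is at most \<open>\<rho>\<close>. The resulting prefixes
  are pairwise incomparable, so their copies of \<open>V\<close> are disjoint, have size comparable with \<open>\<rho>\<close> and lie
  close to the ball; by a packing argument their number is bounded independently of \<open>\<rho>\<close>. Each of them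
  carries mass at most \<open>\<rho>\<^sup>t / c\<close>. Summing over the balls of a cover bounds the sum of the \<open>\<rho>\<^sup>t\<close> from
  below (\<open>finite_ball_cover_bound\<close>), and so the \<open>t\<close>-dimensional measure of \<open>E\<close> is positive.
\<close>

section \<open>Words\<close>

lemma mem_words_iff:
  "js \<in> words N k \<longleftrightarrow> length js = k \<and> (\<forall>i<k. js ! i \<in> N (Suc i))"
proof -
  have "xs \<in> listset As \<longleftrightarrow> list_all2 (\<in>) xs As" for xs :: "nat list" and As
    by (induction As arbitrary: xs) (auto simp: set_Cons_def list_all2_Cons2)
  then show ?thesis
    by (auto simp: words_def list_all2_conv_all_nth simp del: upt_Suc)
qed

lemma words_Suc: "words N (Suc k) = (\<lambda>(us, j). us @ [j]) ` (words N k \<times> N (Suc k))"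
proof (intro set_eqI iffI)
  fix js assume js: "js \<in> words N (Suc k)"
  then obtain us j where "js = us @ [j]"
    by (cases js rule: rev_cases) (auto simp: mem_words_iff)
  moreover have "us ! i \<in> N (Suc i)" if "i < k" for i
    using js that unfolding mem_words_iff \<open>js = us @ [j]\<close>
    by (metis butlast_snoc length_butlast diff_Suc_1 less_SucI nth_append)
  moreover have "j \<in> N (Suc k)" "length us = k"
    using js unfolding mem_words_iff \<open>js = us @ [j]\<close> by auto
  ultimately show "js \<in> (\<lambda>(us, j). us @ [j]) ` (words N k \<times> N (Suc k))"
    by (auto simp: mem_words_iff)
qed (auto simp: mem_words_iff nth_append less_Suc_eq)

lemma prefix_words:
  assumes "js \<in> words N k" "prefix p js"
  shows "p \<in> words N (length p)" "length p \<le> k"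
proof -
  from assms(2) obtain us where js: "js = p @ us"
    by (auto simp: prefix_def)
  then show "length p \<le> k"
    using assms(1) by (auto simp: mem_words_iff)
  show "p \<in> words N (length p)"
    unfolding mem_words_iff
  proof (intro conjI refl allI impI)
    fix i assume "i < length p"
    then show "p ! i \<in> N (Suc i)"
      using assms(1) by (auto simp: mem_words_iff js nth_append dest: spec[of _ i])
  qed
qed

lemma compose_word_Nil [simp]: "compose_word \<psi> [] = id"
  by (simp add: compose_word_def)

lemma compose_word_Cons [simp]: "compose_word \<psi> (j # js) = \<psi> j \<circ> compose_word \<psi> js"
  by (simp add: compose_word_def)

lemma compose_word_append:
  "compose_word \<psi> (us @ vs) = compose_word \<psi> us \<circ> compose_word \<psi> vs"
  by (induction us) (simp_all add: o_assoc)

section \<open>Similitudes and packing in Euclidean space\<close>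

text \<open>
  After translation and division by the ratio the map is an isometry that fixes the origin, hence linear
  and orthogonal. Surjectivity is what makes the image of a ball again a full ball, which the
  separation of cylinders rests on.
\<close>
lemma surj_scaling_map:
  fixes f :: "'a::euclidean_space \<Rightarrow> 'a"
  assumes "c > 0" and f: "\<And>x y. dist (f x) (f y) = c * dist x y"
  shows "surj f"
proof -
  define g where "g x = (1 / c) *\<^sub>R (f x - f 0)" for x
  have "dist (g x) (g y) = dist x y" for x y
    using assms by (simp add: g_def dist_norm flip: scaleR_diff_right)
  then have "orthogonal_transformation g"
    by (simp add: orthogonal_transformation_isometry g_def)
  then have "surj g"
    by (rule orthogonal_transformation_surj)
  show "surj f"
  proof (rule surjI)
    fix y
    have "g (inv g ((1 / c) *\<^sub>R (y - f 0))) = (1 / c) *\<^sub>R (y - f 0)"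
      using \<open>surj g\<close> by (rule surj_f_inv_f)
    then show "f (inv g ((1 / c) *\<^sub>R (y - f 0))) = y"
      using \<open>c > 0\<close> by (simp add: g_def)
  qed
qed

text \<open>
  Rescaling \<open>x\<close> to the origin and \<open>\<rho>\<close> to 1 gives points with mutual distance at least \<open>\<eta>\<close> in the
  compact ball of radius \<open>R\<close>. Finitely many balls of radius \<open>\<eta> / 2\<close> cover it, and each of them contains at
  most one of the points. The bound is uniform in \<open>x\<close> and \<open>\<rho>\<close> because the cover is chosen after rescaling.
\<close>
lemma separated_set_card_bound:
  fixes R \<eta> :: real
  assumes "\<eta> > 0"
  shows "\<exists>C::nat. \<forall>(Q :: 'i set) f (x :: 'a::euclidean_space) \<rho>.
    \<rho> > 0 \<and> (\<forall>p\<in>Q. dist x (f p) \<le> \<rho> * R) \<and>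
      (\<forall>p\<in>Q. \<forall>q\<in>Q. p \<noteq> q \<longrightarrow> \<rho> * \<eta> \<le> dist (f p) (f q)) \<longrightarrow>
    finite Q \<and> card Q \<le> C"
proof -
  obtain T where T: "finite T" "cball (0::'a) R \<subseteq> (\<Union>c\<in>T. ball c (\<eta> / 2))"
    using compact_imp_seq_compact[OF compact_cball[of "0::'a" R], THEN seq_compact_imp_totally_bounded, rule_format, of "\<eta> / 2"]
      \<open>\<eta> > 0\<close> by auto
  show ?thesis
  proof (intro exI[of _ "card T"] allI impI, elim conjE)
    fix Q :: "'i set" and f and x :: 'a and \<rho> :: real
    assume \<rho>: "\<rho> > 0" and near: "\<forall>p\<in>Q. dist x (f p) \<le> \<rho> * R"
      and sep: "\<forall>p\<in>Q. \<forall>q\<in>Q. p \<noteq> q \<longrightarrow> \<rho> * \<eta> \<le> dist (f p) (f q)"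
    define g where "g p = (1 / \<rho>) *\<^sub>R (f p - x)" for p
    have "norm (g p) = dist x (f p) / \<rho>" for p
      using \<rho> by (simp add: g_def dist_norm norm_minus_commute)
    then have "g p \<in> cball 0 R" if "p \<in> Q" for p
      using bspec[OF near that] \<rho> by (simp add: pos_divide_le_eq mult.commute)
    with T have "\<forall>p\<in>Q. \<exists>c\<in>T. g p \<in> ball c (\<eta> / 2)"
      by blast
    then obtain h where h: "h p \<in> T" "g p \<in> ball (h p) (\<eta> / 2)" if "p \<in> Q" for p
      by metis
    have g_dist: "dist (g p) (g q) = dist (f p) (f q) / \<rho>" for p q
      using \<rho> by (simp add: g_def dist_norm flip: scaleR_diff_right)
    have "inj_on h Q"
    proof (rule inj_onI, rule ccontr)
      fix p q assume pq: "p \<in> Q" "q \<in> Q" "h p = h q" "p \<noteq> q"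
      have "\<eta> \<le> dist (g p) (g q)"
        using sep pq \<rho> by (simp add: g_dist field_simps)
      also have "\<dots> < \<eta> / 2 + \<eta> / 2"
        using h(2)[OF pq(1)] h(2)[OF pq(2)] pq(3)
        by (intro dist_triangle_less_add[where y="h p"]) (auto simp: dist_commute)
      finally show False by simp
    qed
    moreover have "h ` Q \<subseteq> T"
      using h(1) by blast
    ultimately show "finite Q \<and> card Q \<le> card T"
      using T(1) by (meson card_inj_on_le inj_on_finite)
  qed
qed

section \<open>Finite covers, Hausdorff distance and Hausdorff premeasure\<close>

lemma sum_le_sum_over_cover:
  fixes f :: "'b \<Rightarrow> real"
  assumes "finite I" "\<And>i. i \<in> I \<Longrightarrow> finite (B i)" "\<And>x. 0 \<le> f x" "A \<subseteq> (\<Union>i\<in>I. B i)"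
  shows "sum f A \<le> (\<Sum>i\<in>I. sum f (B i))"
proof -
  have "sum f A \<le> sum f (\<Union>i\<in>I. B i)"
    using assms by (intro sum_mono2) auto
  also have "\<dots> \<le> (\<Sum>i\<in>I. sum f (B i))"
    using assms(1,2)
  proof (induction I rule: finite_induct)
    case (insert i I)
    have "sum f (B i \<union> (\<Union>i\<in>I. B i)) + sum f (B i \<inter> (\<Union>i\<in>I. B i))
        = sum f (B i) + sum f (\<Union>i\<in>I. B i)"
      using insert by (intro sum.union_inter) auto
    moreover have "0 \<le> sum f (B i \<inter> (\<Union>i\<in>I. B i))"
      using assms(3) by (simp add: sum_nonneg)
    moreover have "sum f (\<Union>i\<in>I. B i) \<le> (\<Sum>i\<in>I. sum f (B i))"
      using insert by auto
    ultimately show ?case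
      using insert(1,2) by simp
  qed simp
  finally show ?thesis .
qed

text \<open>
  Boundedness of both sets makes the suprema in the definition genuine upper bounds.
\<close>
lemma infdist_le_hausdorff_distance:
  assumes "bounded A" "bounded B" "A \<noteq> {}" "B \<noteq> {}"
  shows "x \<in> A \<Longrightarrow> infdist x B \<le> hausdorff_distance A B"
    and "y \<in> B \<Longrightarrow> infdist y A \<le> hausdorff_distance A B"
proof -
  have bdd: "bdd_above ((\<lambda>x. infdist x T) ` S)" if "bounded S" "bounded T" "T \<noteq> {}" for S T :: "'a set"
  proof -
    obtain b where b: "b \<in> T" using \<open>T \<noteq> {}\<close> by blast
    obtain e where e: "\<forall>x\<in>S. dist b x \<le> e"
      using \<open>bounded S\<close> bounded_any_center by blast
    show ?thesis
      using e by (intro bdd_aboveI2[where M = e]) (metis b dist_commute infdist_le2)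
  qed
  show "infdist x B \<le> hausdorff_distance A B" if "x \<in> A"
    unfolding hausdorff_distance_def using bdd[of A B] assms that
    by (intro max.coboundedI1 cSUP_upper) auto
  show "infdist y A \<le> hausdorff_distance A B" if "y \<in> B"
    unfolding hausdorff_distance_def using bdd[of B A] assms that
    by (intro max.coboundedI2 cSUP_upper) auto
qed

lemma diameter_pow_pos_exponent: "t > 0 \<Longrightarrow> diameter_pow t U = ennreal (diameter U powr t)"
  by (simp add: diameter_pow_def)

lemma hausdorff_premeasure_finite_cover:
  fixes U :: "'i \<Rightarrow> 'a::metric_space set"
  assumes "finite I" "A \<subseteq> (\<Union>i\<in>I. U i)" "\<And>i. i \<in> I \<Longrightarrow> bounded (U i)"
    and "\<And>i. i \<in> I \<Longrightarrow> diameter (U i) \<le> \<delta>" "\<delta> \<ge> 0"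
  shows "hausdorff_premeasure t \<delta> A \<le> (\<Sum>i\<in>I. diameter_pow t (U i))"
proof -
  obtain h where h: "bij_betw h {0..<card I} I"
    using ex_bij_betw_nat_finite[OF \<open>finite I\<close>] by blast
  define W where "W n = (if n < card I then U (h n) else {})" for n
  have h_in: "h n \<in> I" if "n < card I" for n
    using h that by (auto simp: bij_betw_def)
  have "(\<Sum>n. diameter_pow t (W n)) = (\<Sum>n<card I. diameter_pow t (W n))"
    by (intro suminf_finite) (auto simp: W_def diameter_pow_def)
  also have "\<dots> = (\<Sum>n\<in>{0..<card I}. diameter_pow t (U (h n)))"
    by (intro sum.cong) (auto simp: W_def)
  also have "\<dots> = (\<Sum>i\<in>I. diameter_pow t (U i))"
    by (rule sum.reindex_bij_betw[OF h])
  finally have sum_W: "(\<Sum>n. diameter_pow t (W n)) = (\<Sum>i\<in>I. diameter_pow t (U i))" .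
  have "A \<subseteq> (\<Union>n. W n)"
  proof
    fix x assume "x \<in> A"
    then obtain i where i: "i \<in> I" "x \<in> U i" using assms(2) by blast
    then obtain n where "n < card I" "i = h n"
      using bij_betw_imp_surj_on[OF h] by fastforce
    with i show "x \<in> (\<Union>n. W n)" by (auto simp: W_def)
  qed
  moreover have "\<forall>n. bounded (W n) \<and> diameter (W n) \<le> \<delta>"
    using assms(3-5) h_in by (auto simp: W_def)
  ultimately show ?thesis
    unfolding hausdorff_premeasure_def sum_W[symmetric] by (intro INF_lower) auto
qed

section \<open>Systems with the open set condition\<close>

locale open_set_system =
  fixes \<psi> :: "nat \<Rightarrow> 'a::euclidean_space \<Rightarrow> 'a"
    and r :: "nat \<Rightarrow> real"
    and m :: nat
    and N :: "nat \<Rightarrow> nat set"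
    and V :: "'a set"
  assumes similitude: "j \<in> {1..m} \<Longrightarrow> similitude (\<psi> j) (r j)"
    and V_nonempty: "V \<noteq> {}"
    and V_bounded: "bounded V"
    and V_open: "open V"
    and V_invariant: "j \<in> {1..m} \<Longrightarrow> \<psi> j ` V \<subseteq> V"
    and V_disjoint: "i \<in> {1..m} \<Longrightarrow> j \<in> {1..m} \<Longrightarrow> i \<noteq> j \<Longrightarrow> \<psi> i ` V \<inter> \<psi> j ` V = {}"
    and N_nonempty: "k \<ge> 1 \<Longrightarrow> N k \<noteq> {}"
    and N_subset: "k \<ge> 1 \<Longrightarrow> N k \<subseteq> {1..m}"
begin

abbreviation ratio :: "nat list \<Rightarrow> real" where
  "ratio js \<equiv> prod_list (map r js)"

definition mass :: "real \<Rightarrow> nat \<Rightarrow> real" where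
  "mass t k = (\<Sum>js\<in>words N k. ratio js powr t)"

lemma r_pos: "j \<in> {1..m} \<Longrightarrow> 0 < r j"
  and r_less_1: "j \<in> {1..m} \<Longrightarrow> r j < 1"
  and dist_psi: "j \<in> {1..m} \<Longrightarrow> dist (\<psi> j x) (\<psi> j y) = r j * dist x y"
  using similitude by (auto simp: similitude_def)

lemma finite_N: "k \<ge> 1 \<Longrightarrow> finite (N k)"
  using N_subset finite_subset by blast

lemma finite_words: "finite (words N k)"
proof (induction k)
  case 0
  then show ?case by (simp add: words_def)
next
  case (Suc k)
  then show ?case by (simp add: words_Suc finite_N)
qed

lemma words_nonempty: "words N k \<noteq> {}"
proof (induction k)
  case 0
  then show ?case by (simp add: words_def)
next
  case (Suc k)
  then show ?case using N_nonempty[of "Suc k"] by (auto simp: words_Suc)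
qed

lemma set_words: "js \<in> words N k \<Longrightarrow> set js \<subseteq> {1..m}"
  using N_subset by (fastforce simp: mem_words_iff in_set_conv_nth)

lemma ratio_pos: "set js \<subseteq> {1..m} \<Longrightarrow> 0 < ratio js"
  by (induction js) (use r_pos in auto)

lemma dist_compose_word:
  "set js \<subseteq> {1..m} \<Longrightarrow> dist (compose_word \<psi> js x) (compose_word \<psi> js y) = ratio js * dist x y"
  by (induction js) (auto simp: dist_psi)

lemma surj_compose_word: "set js \<subseteq> {1..m} \<Longrightarrow> surj (compose_word \<psi> js)"
  using surj_scaling_map[OF ratio_pos dist_compose_word] .

lemma inj_compose_word:
  assumes "set js \<subseteq> {1..m}"
  shows "inj (compose_word \<psi> js)"
proof (rule injI)
  fix x y assume "compose_word \<psi> js x = compose_word \<psi> js y"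
  then have "ratio js * dist x y = 0"
    using dist_compose_word[OF assms, of x y] by simp
  then show "x = y"
    using ratio_pos[OF assms] by simp
qed

lemma continuous_compose_word: "set js \<subseteq> {1..m} \<Longrightarrow> continuous_on S (compose_word \<psi> js)"
  by (rule lipschitz_on_continuous_on[OF lipschitz_onI])
    (auto simp: dist_compose_word ratio_pos less_imp_le)

lemma compose_word_V: "set js \<subseteq> {1..m} \<Longrightarrow> compose_word \<psi> js ` V \<subseteq> V"
  by (induction js) (use V_invariant in \<open>auto simp: image_subset_iff\<close>)

lemma psi_closure_V:
  assumes "j \<in> {1..m}"
  shows "\<psi> j ` closure V \<subseteq> closure V"
proof (rule image_closure_subset)
  show "continuous_on (closure V) (\<psi> j)"
    using continuous_compose_word[of "[j]"] assms by simp
  show "\<psi> j ` V \<subseteq> closure V"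
    using V_invariant[OF assms] closure_subset by blast
qed simp

text \<open>
  Let \<open>us\<close> be the longest common prefix of the two words. The images of \<open>V\<close> under what follows \<open>us\<close> lie in
  two different sets \<open>\<psi> i ` V\<close> and \<open>\<psi> j ` V\<close>, and the injective map of \<open>us\<close> keeps these disjoint.
\<close>
lemma parallel_words_disjoint:
  assumes p: "set p \<subseteq> {1..m}" and q: "set q \<subseteq> {1..m}" and par: "p \<parallel> q"
  shows "compose_word \<psi> p ` V \<inter> compose_word \<psi> q ` V = {}"
proof -
  obtain us i vs j ws where eq: "i \<noteq> j" "p = us @ i # vs" "q = us @ j # ws"
    using parallel_decomp[OF par] by blast
  have *: "compose_word \<psi> (us @ i # vs) ` V \<subseteq> compose_word \<psi> us ` \<psi> i ` V"
    if "set vs \<subseteq> {1..m}" for us i vs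
    using compose_word_V[OF that] by (auto simp: compose_word_append)
  have "compose_word \<psi> us ` \<psi> i ` V \<inter> compose_word \<psi> us ` \<psi> j ` V = {}"
    using V_disjoint[of i j] inj_compose_word[of us] p q
    by (subst image_Int[symmetric]) (auto simp: eq)
  moreover have "set vs \<subseteq> {1..m}" "set ws \<subseteq> {1..m}"
    using p q by (auto simp: eq)
  ultimately show ?thesis
    using *[of vs us i] *[of ws us j] unfolding eq by blast
qed

text \<open>
  The image of \<open>ball v a\<close> under \<open>p\<close> is the full ball of radius \<open>ratio p * a\<close> about the image of \<open>v\<close>. It
  lies in the copy of \<open>V\<close> belonging to \<open>p\<close>, so it cannot contain a point of the copy belonging to \<open>q\<close>.
\<close>
lemma parallel_words_separated:
  assumes p: "set p \<subseteq> {1..m}" and q: "set q \<subseteq> {1..m}" and par: "p \<parallel> q"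
    and v: "v \<in> V" and ball: "ball v a \<subseteq> V"
  shows "ratio p * a \<le> dist (compose_word \<psi> p v) (compose_word \<psi> q v)"
proof (rule ccontr)
  assume close: "\<not> ?thesis"
  obtain y where y: "compose_word \<psi> p y = compose_word \<psi> q v"
    using surj_compose_word[OF p] by (metis surjD)
  have "ratio p * dist v y < ratio p * a"
    using dist_compose_word[OF p, of v y] y close by simp
  then have "y \<in> V"
    using ratio_pos[OF p] ball by auto
  then show False
    using parallel_words_disjoint[OF p q par] v y by (metis disjoint_iff image_eqI)
qed

text \<open>
  The weight of a word is multiplicative and the letters at position \<open>k + 1\<close> are chosen independently of
  the preceding ones. The set \<open>A\<close> is arbitrary so that the words with a given prefix are covered too.
\<close>
lemma sum_append_letters:
  assumes "A \<subseteq> words N k"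
  shows "(\<Sum>js\<in>(\<lambda>(us, j). us @ [j]) ` (A \<times> N (Suc k)). ratio js powr t)
       = (\<Sum>js\<in>A. ratio js powr t) * (\<Sum>j\<in>N (Suc k). r j powr t)"
proof -
  have "(\<Sum>js\<in>(\<lambda>(us, j). us @ [j]) ` (A \<times> N (Suc k)). ratio js powr t)
      = (\<Sum>(us, j)\<in>A \<times> N (Suc k). ratio (us @ [j]) powr t)"
    by (subst sum.reindex) (auto intro!: inj_onI sum.cong)
  also have "\<dots> = (\<Sum>(us, j)\<in>A \<times> N (Suc k). ratio us powr t * r j powr t)"
  proof (intro sum.cong refl, clarify)
    fix us j assume "us \<in> A" "j \<in> N (Suc k)"
    then have "0 < ratio us" "0 < r j"
      using assms ratio_pos set_words N_subset[of "Suc k"] r_pos by (blast, force)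
    then show "ratio (us @ [j]) powr t = ratio us powr t * r j powr t"
      by (simp add: powr_mult)
  qed
  finally show ?thesis
    by (simp add: sum_product sum.cartesian_product)
qed

lemma mass_Suc: "mass t (Suc k) = mass t k * (\<Sum>j\<in>N (Suc k). r j powr t)"
  unfolding mass_def words_Suc by (rule sum_append_letters) simp

lemma mass_pos: "mass t k > 0"
  unfolding mass_def
proof (rule sum_pos[OF finite_words words_nonempty])
  fix js assume "js \<in> words N k"
  then show "0 < ratio js powr t"
    using ratio_pos[OF set_words, of js k] by simp
qed

text \<open>
  The consistency of the measure that gives a word \<open>p\<close> of length \<open>l\<close> the mass
  \<open>ratio p powr t / mass t l\<close>: the words of length \<open>k\<close> that extend \<open>p\<close> have the same total mass as \<open>p\<close>.
\<close>
lemma mass_extensions: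
  assumes p: "p \<in> words N l" and "l \<le> k"
  shows "mass t l * (\<Sum>js\<in>{js \<in> words N k. prefix p js}. ratio js powr t) = ratio p powr t * mass t k"
  using \<open>l \<le> k\<close>
proof (induction k rule: dec_induct)
  case base
  have "{js \<in> words N l. prefix p js} = {p}"
    using p by (auto simp: prefix_def mem_words_iff)
  then show ?case by simp
next
  case (step k)
  have "{js \<in> words N (Suc k). prefix p js}
      = (\<lambda>(us, j). us @ [j]) ` ({js \<in> words N k. prefix p js} \<times> N (Suc k))"
    using p step(1) unfolding words_Suc by (force simp: mem_words_iff)
  then have "(\<Sum>js\<in>{js \<in> words N (Suc k). prefix p js}. ratio js powr t)
      = (\<Sum>js\<in>{js \<in> words N k. prefix p js}. ratio js powr t) * (\<Sum>j\<in>N (Suc k). r j powr t)"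
    using sum_append_letters[of "{js \<in> words N k. prefix p js}" k t] by simp
  then show ?case
    using step.IH by (simp add: mass_Suc flip: mult.assoc)
qed

section \<open>Approximation of the attractor\<close>

lemma ratio_uniformly_small:
  assumes "\<rho> > 0"
  shows "\<forall>\<^sub>F k in sequentially. \<forall>js\<in>words N k. ratio js \<le> \<rho>"
proof -
  define R where "R = Max (r ` {1..m})"
  have "{1..m} \<noteq> {}"
    using N_nonempty[of 1] N_subset[of 1] by auto
  then have R: "0 < R" "R < 1" and r_le_R: "\<And>j. j \<in> {1..m} \<Longrightarrow> r j \<le> R"
    using r_pos r_less_1 by (auto simp: R_def Max_gr_iff)
  have ratio_le: "ratio js \<le> R ^ length js" if "set js \<subseteq> {1..m}" for js
    using that
  proof (induction js)
    case (Cons j js)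
    then show ?case
      using r_le_R[of j] r_pos[of j] ratio_pos[of js] R by (auto intro!: mult_mono)
  qed simp
  have "(\<lambda>k. R ^ k) \<longlonglongrightarrow> 0"
    using R by (intro LIMSEQ_realpow_zero) auto
  then have "\<forall>\<^sub>F k in sequentially. R ^ k < \<rho>"
    using assms by (rule order_tendstoD)
  then show ?thesis
  proof eventually_elim
    case (elim k)
    show ?case
    proof
      fix js assume js: "js \<in> words N k"
      have "ratio js \<le> R ^ length js"
        using set_words[OF js] by (rule ratio_le)
      also have "length js = k"
        using js by (simp add: mem_words_iff)
      finally show "ratio js \<le> \<rho>"
        using elim by simp
    qed
  qed
qed

lemma compact_image_word:
  assumes "set js \<subseteq> {1..m}"
  shows "compact (compose_word \<psi> js ` closure V)"
  using V_bounded continuous_compose_word[OF assms] by (intro compact_continuous_image) auto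

lemma compact_iterate_image: "compact (iterate_image \<psi> N k (closure V))"
  unfolding iterate_image_def
  by (rule compact_UN[OF finite_words]) (rule compact_image_word[OF set_words])

lemma iterate_image_nonempty: "iterate_image \<psi> N k (closure V) \<noteq> {}"
  by (simp add: iterate_image_def words_nonempty V_nonempty)

lemma iterate_image_antimono:
  assumes "k \<le> l"
  shows "iterate_image \<psi> N l (closure V) \<subseteq> iterate_image \<psi> N k (closure V)"
  using assms
proof (induction rule: dec_induct)
  case (step l)
  have "iterate_image \<psi> N (Suc l) (closure V) \<subseteq> iterate_image \<psi> N l (closure V)"
  proof
    fix x assume "x \<in> iterate_image \<psi> N (Suc l) (closure V)"
    then obtain us j y where us: "us \<in> words N l" "j \<in> N (Suc l)" "y \<in> closure V"
        and x: "x = compose_word \<psi> (us @ [j]) y"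
      by (auto simp: iterate_image_def words_Suc)
    have "j \<in> {1..m}"
      using N_subset[of "Suc l"] us(2) by auto
    then have "\<psi> j y \<in> closure V"
      using psi_closure_V us(3) by blast
    with us(1) show "x \<in> iterate_image \<psi> N l (closure V)"
      unfolding iterate_image_def x compose_word_append by auto
  qed
  with step.IH show ?case by blast
qed simp

text \<open>
  As the sets decrease, the distance from \<open>x\<close> to the \<open>k\<close>-th one is at most its distance to any later one,
  and the latter distances tend to 0. So \<open>x\<close> has distance 0 from a closed set.
\<close>
lemma attractor_subset_iterate_image:
  assumes E: "statistically_self_similar_set \<psi> N E"
  shows "E \<subseteq> iterate_image \<psi> N k (closure V)"
proof
  fix x assume "x \<in> E"
  let ?K = "\<lambda>k. iterate_image \<psi> N k (closure V)"
  have lim: "(\<lambda>l. hausdorff_distance (?K l) E) \<longlonglongrightarrow> 0"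
    using E V_bounded V_nonempty unfolding statistically_self_similar_set_def by auto
  have "infdist x (?K k) \<le> hausdorff_distance (?K l) E" if "l \<ge> k" for l
  proof -
    have "infdist x (?K k) \<le> infdist x (?K l)"
      using iterate_image_antimono[OF that] iterate_image_nonempty by (rule infdist_mono)
    also have "\<dots> \<le> hausdorff_distance (?K l) E"
      using E \<open>x \<in> E\<close> compact_iterate_image iterate_image_nonempty
      unfolding statistically_self_similar_set_def
      by (intro infdist_le_hausdorff_distance(2)) (auto intro: compact_imp_bounded)
    finally show ?thesis .
  qed
  then have "infdist x (?K k) \<le> 0"
    by (intro LIMSEQ_le_const[OF lim]) blast
  then show "x \<in> ?K k"
    using in_closed_iff_infdist_zero[OF compact_imp_closed[OF compact_iterate_image] iterate_image_nonempty]
      infdist_nonneg[of x "?K k"] by (metis order_antisym)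
qed

text \<open>
  By compactness \<open>U\<close> contains a neighbourhood of \<open>E\<close> of some uniform width, and convergence in the
  Hausdorff distance brings the approximations into it.
\<close>
lemma iterate_image_eventually_subset:
  assumes E: "statistically_self_similar_set \<psi> N E" and "open U" "E \<subseteq> U"
  shows "\<forall>\<^sub>F k in sequentially. iterate_image \<psi> N k (closure V) \<subseteq> U"
proof -
  let ?K = "\<lambda>k. iterate_image \<psi> N k (closure V)"
  have E': "compact E" "E \<noteq> {}" and lim: "(\<lambda>l. hausdorff_distance (?K l) E) \<longlonglongrightarrow> 0"
    using E V_bounded V_nonempty unfolding statistically_self_similar_set_def by auto
  obtain e where e: "e > 0" "(\<Union>x\<in>E. ball x e) \<subseteq> U"
    using compact_subset_open_imp_ball_epsilon_subset[OF \<open>compact E\<close> \<open>open U\<close> \<open>E \<subseteq> U\<close>] by blast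
  have "\<forall>\<^sub>F k in sequentially. hausdorff_distance (?K k) E < e"
    using lim e(1) by (rule order_tendstoD)
  then show ?thesis
  proof eventually_elim
    case (elim k)
    show ?case
    proof
      fix y assume "y \<in> ?K k"
      have "infdist y E \<le> hausdorff_distance (?K k) E"
        using E' \<open>y \<in> ?K k\<close> compact_iterate_image iterate_image_nonempty
        by (intro infdist_le_hausdorff_distance(1)) (auto intro: compact_imp_bounded)
      with elim obtain x where "x \<in> E" "dist y x < e"
        using infdist_attains_inf[OF compact_imp_closed[OF \<open>compact E\<close>] \<open>E \<noteq> {}\<close>] by (metis order_le_less_trans)
      then have "y \<in> (\<Union>x\<in>E. ball x e)" by (auto simp: dist_commute)
      with e(2) show "y \<in> U" by blast
    qed
  qed
qed

section \<open>Upper bound: covers by cylinders\<close>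

text \<open>
  Small mass is needed only at infinitely many levels, because the diameters of the cylinders become
  small at all late levels; this is why the lower limit is the relevant one.
\<close>
lemma hausdorff_measure_zero_if_mass_small:
  assumes E: "statistically_self_similar_set \<psi> N E" and "t > 0"
    and small: "\<And>e. e > 0 \<Longrightarrow> \<exists>\<^sub>F k in sequentially. mass t k < e"
  shows "hausdorff_measure t E = 0"
proof -
  \<comment> \<open>Adding 1 makes \<open>D\<close> positive, so that one can divide by it.\<close>
  define D where "D = diameter (closure V) + 1"
  have D: "D > 0" "diameter (closure V) \<le> D"
    using diameter_ge_0[OF bounded_closure[OF V_bounded]] by (auto simp: D_def)
  have "hausdorff_premeasure t \<delta> E = 0" if "\<delta> > 0" for \<delta>
  proof -
    have "hausdorff_premeasure t \<delta> E \<le> 0 + ennreal e" if "e > 0" for e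
    proof -
      have "\<exists>\<^sub>F k in sequentially. mass t k < e / D powr t \<and> (\<forall>js\<in>words N k. ratio js \<le> \<delta> / D)"
        using D \<open>e > 0\<close> \<open>\<delta> > 0\<close>
        by (intro frequently_eventually_frequently small ratio_uniformly_small) auto
      then obtain k where k: "mass t k < e / D powr t" "\<And>js. js \<in> words N k \<Longrightarrow> ratio js \<le> \<delta> / D"
        by (auto dest: frequently_ex)
      have diam: "diameter (compose_word \<psi> js ` closure V) \<le> ratio js * D" if "js \<in> words N k" for js
      proof (rule diameter_le)
        have *: "set js \<subseteq> {1..m}" using that by (rule set_words)
        show "compose_word \<psi> js ` closure V \<noteq> {} \<or> 0 \<le> ratio js * D"
          using V_nonempty by simp
        fix x y assume "x \<in> compose_word \<psi> js ` closure V" "y \<in> compose_word \<psi> js ` closure V"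
        then obtain x' y' where "x' \<in> closure V" "y' \<in> closure V"
            "x = compose_word \<psi> js x'" "y = compose_word \<psi> js y'"
          by blast
        then show "norm (x - y) \<le> ratio js * D"
          using dist_compose_word[OF *, of x' y'] D(2) ratio_pos[OF *]
            diameter_bounded_bound[OF bounded_closure[OF V_bounded], of x' y']
          by (simp add: dist_norm)
      qed
      have "hausdorff_premeasure t \<delta> E
          \<le> (\<Sum>js\<in>words N k. diameter_pow t (compose_word \<psi> js ` closure V))"
      proof (rule hausdorff_premeasure_finite_cover[OF finite_words])
        show "E \<subseteq> (\<Union>js\<in>words N k. compose_word \<psi> js ` closure V)"
          using attractor_subset_iterate_image[OF E] by (simp add: iterate_image_def)
        fix js assume js: "js \<in> words N k"
        show "bounded (compose_word \<psi> js ` closure V)"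
          using compact_image_word set_words js compact_imp_bounded by blast
        show "diameter (compose_word \<psi> js ` closure V) \<le> \<delta>"
          using diam[OF js] k(2)[OF js] D(1) by (simp add: field_simps)
      qed (use \<open>\<delta> > 0\<close> in simp)
      also have "\<dots> \<le> (\<Sum>js\<in>words N k. ennreal (ratio js powr t * D powr t))"
      proof (rule sum_mono)
        fix js assume js: "js \<in> words N k"
        have "diameter (compose_word \<psi> js ` closure V) powr t \<le> (ratio js * D) powr t"
          using diam[OF js] \<open>t > 0\<close> compact_image_word[OF set_words[OF js]]
          by (intro powr_mono2) (auto intro!: diameter_ge_0 compact_imp_bounded)
        then show "diameter_pow t (compose_word \<psi> js ` closure V) \<le> ennreal (ratio js powr t * D powr t)"
          using \<open>t > 0\<close> D(1) ratio_pos[OF set_words[OF js]]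
          by (simp add: diameter_pow_pos_exponent powr_mult ennreal_leI)
      qed
      also have "\<dots> = ennreal (mass t k * D powr t)"
        by (simp add: mass_def sum_distrib_right)
      also have "\<dots> \<le> ennreal e"
        using k(1) D(1) by (intro ennreal_leI) (simp add: field_simps)
      finally show ?thesis by simp
    qed
    then have "hausdorff_premeasure t \<delta> E \<le> 0"
      by (rule ennreal_le_epsilon)
    then show ?thesis by simp
  qed
  then show ?thesis
    by (auto simp: hausdorff_measure_def intro!: SUP_eq_const)
qed

section \<open>Lower bound: the mass of a ball\<close>

text \<open>
  The words at which the ratio first drops to \<open>\<rho>\<close> or below. Cutting at a ratio and not at a fixed length
  makes all cylinders comparable in size with \<open>\<rho>\<close>, however different the ratios of the maps are.
\<close>
definition stopped_words :: "real \<Rightarrow> nat list set" where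
  "stopped_words \<rho> = {p. ratio p \<le> \<rho> \<and> (\<forall>q. strict_prefix q p \<longrightarrow> \<rho> < ratio q)}"

lemma stopped_prefix_exists:
  "ratio js \<le> \<rho> \<Longrightarrow> \<exists>p\<in>stopped_words \<rho>. prefix p js"
proof (induction js rule: length_induct)
  case (1 js)
  show ?case
  proof (cases "js \<in> stopped_words \<rho>")
    case False
    then obtain q where q: "strict_prefix q js" "ratio q \<le> \<rho>"
      using 1(2) by (auto simp: stopped_words_def not_less)
    then obtain p where "p \<in> stopped_words \<rho>" "prefix p q"
      using 1(1) prefix_length_less by blast
    moreover have "prefix p js"
      using \<open>prefix p q\<close> q(1) by (auto simp: prefix_def strict_prefix_def)
    ultimately show ?thesis by blast
  qed auto
qed

lemma stopped_words_parallel: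
  assumes "p \<in> stopped_words \<rho>" "q \<in> stopped_words \<rho>" "p \<noteq> q"
  shows "p \<parallel> q"
  using assms by (force simp: stopped_words_def parallel_def strict_prefix_def)

lemma stopped_words_ratio_ge:
  assumes p: "p \<in> stopped_words \<rho>" "set p \<subseteq> {1..m}"
    and \<rho>: "0 < \<rho>" "\<rho> \<le> 1" and a: "0 < a" "a \<le> 1" "\<And>j. j \<in> {1..m} \<Longrightarrow> a \<le> r j"
  shows "a * \<rho> \<le> ratio p"
proof (cases p rule: rev_cases)
  case Nil
  then show ?thesis using \<rho> a by (simp add: mult_le_one)
next
  case (snoc q j)
  then have "\<rho> < ratio q" "a \<le> r j"
    using p a(3) by (auto simp: stopped_words_def strict_prefix_def)
  then have "a * \<rho> \<le> r j * ratio q"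
    using \<rho> a by (intro mult_mono) auto
  then show ?thesis by (simp add: snoc mult.commute)
qed

text \<open>
  The weights of words of length \<open>k\<close>, divided by \<open>mass t k\<close>, give a ball of radius \<open>\<rho>\<close> mass at most
  \<open>(C / c) * \<rho> powr t\<close>. The stopped prefixes of the words that hit the ball send \<open>v\<close> to points within
  \<open>\<rho> * (1 + diameter V)\<close> of the centre that are separated by a multiple of \<open>\<rho>\<close>, so there are at most \<open>C\<close> of
  them, and each carries mass at most \<open>\<rho> powr t / c\<close>. The constant \<open>C\<close> depends on \<open>V\<close>, \<open>v\<close> and the ratios only.
\<close>
lemma ball_mass_bound:
  assumes v: "v \<in> V"
  obtains C :: real where "C > 0" and
    "\<And>x \<rho> k t c. 0 < \<rho> \<Longrightarrow> \<rho> \<le> 1 \<Longrightarrow> (\<And>js. js \<in> words N k \<Longrightarrow> ratio js \<le> \<rho>) \<Longrightarrow> 0 \<le> t \<Longrightarrow>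
       0 < c \<Longrightarrow> (\<And>l. c \<le> mass t l) \<Longrightarrow>
       c * (\<Sum>js\<in>{js \<in> words N k. compose_word \<psi> js v \<in> ball x \<rho>}. ratio js powr t)
         \<le> C * \<rho> powr t * mass t k"
proof -
  define D where "D = diameter V"
  \<comment> \<open>The element 1 keeps the minimum at most 1, as needed for the empty word, and well defined.\<close>
  define a where "a = Min (insert 1 (r ` {1..m}))"
  have a: "0 < a" "a \<le> 1" and a_le: "\<And>j. j \<in> {1..m} \<Longrightarrow> a \<le> r j"
    using r_pos unfolding a_def by (force, force, intro Min_le) auto
  obtain b where b: "b > 0" "ball v b \<subseteq> V"
    using V_open v open_contains_ball by blast
  obtain C :: nat where C: "\<forall>(Q :: nat list set) f (x :: 'a) \<rho>.
      \<rho> > 0 \<and> (\<forall>p\<in>Q. dist x (f p) \<le> \<rho> * (1 + D)) \<and>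
        (\<forall>p\<in>Q. \<forall>q\<in>Q. p \<noteq> q \<longrightarrow> \<rho> * (a * b) \<le> dist (f p) (f q)) \<longrightarrow>
      finite Q \<and> card Q \<le> C"
    using separated_set_card_bound[OF mult_pos_pos[OF a(1) b(1)]] by (rule exE)
  show thesis
  proof (rule that[of "real C + 1"])
    fix x :: 'a and \<rho> t c :: real and k :: nat
    assume \<rho>: "0 < \<rho>" "\<rho> \<le> 1" and small: "\<And>js. js \<in> words N k \<Longrightarrow> ratio js \<le> \<rho>"
      and "0 \<le> t" "0 < c" and c: "\<And>l. c \<le> mass t l"
    define B where "B = {js \<in> words N k. compose_word \<psi> js v \<in> ball x \<rho>}"
    define Q where "Q = {p \<in> stopped_words \<rho>. \<exists>js\<in>B. prefix p js}"
    have Q_word: "p \<in> words N (length p)" "length p \<le> k" if p: "p \<in> Q" for p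
    proof -
      obtain js where "js \<in> words N k" "prefix p js"
        using p by (auto simp: Q_def B_def)
      then show "p \<in> words N (length p)" "length p \<le> k"
        by (rule prefix_words)+
    qed
    then have Q_letters: "set p \<subseteq> {1..m}" if "p \<in> Q" for p
      using set_words that by blast
    have "finite Q \<and> card Q \<le> C"
    proof (rule C[rule_format, where f = "\<lambda>p. compose_word \<psi> p v"], intro conjI ballI impI)
      show "\<rho> > 0" by (rule \<rho>(1))
    next
      fix p assume p: "p \<in> Q"
      then obtain us where us: "p @ us \<in> B"
        by (auto simp: Q_def prefix_def)
      then have "set us \<subseteq> {1..m}"
        using set_words[of "p @ us" k] by (auto simp: B_def)
      then have "compose_word \<psi> us v \<in> V"
        using compose_word_V v by blast
      then have "dist (compose_word \<psi> us v) v \<le> D"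
        unfolding D_def using V_bounded v by (intro diameter_bounded_bound) auto
      moreover have "ratio p \<le> \<rho>" "0 < ratio p"
        using p ratio_pos[OF Q_letters[OF p]] by (auto simp: Q_def stopped_words_def)
      ultimately have "dist (compose_word \<psi> (p @ us) v) (compose_word \<psi> p v) \<le> \<rho> * D"
        using dist_compose_word[OF Q_letters[OF p], of "compose_word \<psi> us v" v]
        by (simp add: compose_word_append mult_mono)
      moreover have "dist x (compose_word \<psi> (p @ us) v) < \<rho>"
        using us by (simp add: B_def)
      ultimately show "dist x (compose_word \<psi> p v) \<le> \<rho> * (1 + D)"
        using dist_triangle[of x "compose_word \<psi> p v" "compose_word \<psi> (p @ us) v"]
        by (simp add: algebra_simps)
    next
      fix p q assume pq: "p \<in> Q" "q \<in> Q" "p \<noteq> q"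
      then have "p \<parallel> q"
        using stopped_words_parallel by (auto simp: Q_def)
      have "a * \<rho> \<le> ratio p"
        using pq(1) Q_letters \<rho> a a_le by (intro stopped_words_ratio_ge) (auto simp: Q_def)
      then have "a * \<rho> * b \<le> ratio p * b"
        using b by simp
      also have "\<dots> \<le> dist (compose_word \<psi> p v) (compose_word \<psi> q v)"
        using parallel_words_separated[OF Q_letters[OF pq(1)] Q_letters[OF pq(2)] \<open>p \<parallel> q\<close> v b(2)] .
      finally show "\<rho> * (a * b) \<le> dist (compose_word \<psi> p v) (compose_word \<psi> q v)"
        by (simp add: mult_ac)
    qed
    then have Q: "finite Q" "card Q \<le> C" by auto
    have "B \<subseteq> (\<Union>p\<in>Q. {js \<in> words N k. prefix p js})"
    proof
      fix js assume "js \<in> B"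
      then obtain p where "p \<in> stopped_words \<rho>" "prefix p js"
        using small stopped_prefix_exists by (metis (no_types, lifting) B_def mem_Collect_eq)
      with \<open>js \<in> B\<close> show "js \<in> (\<Union>p\<in>Q. {js \<in> words N k. prefix p js})"
        by (auto simp: Q_def B_def)
    qed
    then have "(\<Sum>js\<in>B. ratio js powr t) \<le> (\<Sum>p\<in>Q. \<Sum>js\<in>{js \<in> words N k. prefix p js}. ratio js powr t)"
      using Q finite_words by (intro sum_le_sum_over_cover) auto
    then have "c * (\<Sum>js\<in>B. ratio js powr t)
        \<le> (\<Sum>p\<in>Q. c * (\<Sum>js\<in>{js \<in> words N k. prefix p js}. ratio js powr t))"
      using \<open>c > 0\<close> by (simp flip: sum_distrib_left)
    also have "\<dots> \<le> (\<Sum>p\<in>Q. \<rho> powr t * mass t k)"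
    proof (rule sum_mono)
      fix p assume p: "p \<in> Q"
      have "c * (\<Sum>js\<in>{js \<in> words N k. prefix p js}. ratio js powr t)
          \<le> mass t (length p) * (\<Sum>js\<in>{js \<in> words N k. prefix p js}. ratio js powr t)"
        using c by (intro mult_right_mono sum_nonneg) auto
      also have "\<dots> = ratio p powr t * mass t k"
        using Q_word[OF p] by (rule mass_extensions)
      also have "\<dots> \<le> \<rho> powr t * mass t k"
        using p \<open>t \<ge> 0\<close> ratio_pos[OF Q_letters[OF p]] mass_pos[of t k]
        by (intro mult_right_mono powr_mono2) (auto simp: Q_def stopped_words_def)
      finally show "c * (\<Sum>js\<in>{js \<in> words N k. prefix p js}. ratio js powr t) \<le> \<rho> powr t * mass t k" .
    qed
    also have "\<dots> = real (card Q) * (\<rho> powr t * mass t k)"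
      by simp
    also have "\<dots> \<le> (real C + 1) * (\<rho> powr t * mass t k)"
      using Q(2) mass_pos[of t k] by (intro mult_right_mono) auto
    finally show "c * (\<Sum>js\<in>{js \<in> words N k. compose_word \<psi> js v \<in> ball x \<rho>}. ratio js powr t)
         \<le> (real C + 1) * \<rho> powr t * mass t k"
      by (simp add: B_def mult.assoc)
  qed simp
qed

text \<open>
  The finitely many balls also cover the approximation of level \<open>k\<close> for some \<open>k\<close> that is so large that all
  words of length \<open>k\<close> have ratio below every radius. Each of these words hits some ball, so the masses of
  the balls add up to at least the total mass.
\<close>
lemma finite_ball_cover_bound:
  assumes E: "statistically_self_similar_set \<psi> N E"
    and t: "0 \<le> t" and c: "0 < c" "\<And>l. c \<le> mass t l"
  obtains \<kappa> :: real where "\<kappa> > 0" and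
    "\<And>(J :: 'i set) x \<rho>. finite J \<Longrightarrow> (\<And>i. i \<in> J \<Longrightarrow> 0 < \<rho> i \<and> \<rho> i \<le> 1) \<Longrightarrow>
       E \<subseteq> (\<Union>i\<in>J. ball (x i) (\<rho> i)) \<Longrightarrow> \<kappa> \<le> (\<Sum>i\<in>J. \<rho> i powr t)"
proof -
  obtain v where v: "v \<in> V" using V_nonempty by blast
  obtain C where C: "C > 0" and ball_bound:
    "\<And>x \<rho> k. 0 < \<rho> \<Longrightarrow> \<rho> \<le> 1 \<Longrightarrow> (\<And>js. js \<in> words N k \<Longrightarrow> ratio js \<le> \<rho>) \<Longrightarrow>
       c * (\<Sum>js\<in>{js \<in> words N k. compose_word \<psi> js v \<in> ball x \<rho>}. ratio js powr t)
         \<le> C * \<rho> powr t * mass t k"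
  proof (rule ball_mass_bound[OF v])
    fix C :: real
    assume "C > 0" and *: "\<And>x \<rho> k t c. 0 < \<rho> \<Longrightarrow> \<rho> \<le> 1 \<Longrightarrow> (\<And>js. js \<in> words N k \<Longrightarrow> ratio js \<le> \<rho>) \<Longrightarrow> 0 \<le> t \<Longrightarrow>
       0 < c \<Longrightarrow> (\<And>l. c \<le> mass t l) \<Longrightarrow>
       c * (\<Sum>js\<in>{js \<in> words N k. compose_word \<psi> js v \<in> ball x \<rho>}. ratio js powr t)
         \<le> C * \<rho> powr t * mass t k"
    show thesis
      by (rule that[OF \<open>C > 0\<close>], rule *) (use t c in auto)
  qed
  show thesis
  proof (rule that[of "c / C"])
    fix J :: "'i set" and x \<rho>
    assume J: "finite J" and \<rho>: "\<And>i. i \<in> J \<Longrightarrow> 0 < \<rho> i \<and> \<rho> i \<le> 1"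
      and cover: "E \<subseteq> (\<Union>i\<in>J. ball (x i) (\<rho> i))"
    have "\<forall>\<^sub>F k in sequentially. iterate_image \<psi> N k (closure V) \<subseteq> (\<Union>i\<in>J. ball (x i) (\<rho> i))"
      using cover by (intro iterate_image_eventually_subset[OF E]) auto
    moreover have "\<forall>\<^sub>F k in sequentially. \<forall>i\<in>J. \<forall>js\<in>words N k. ratio js \<le> \<rho> i"
      using J \<rho> ratio_uniformly_small by (intro eventually_ball_finite) auto
    ultimately have "\<forall>\<^sub>F k in sequentially. iterate_image \<psi> N k (closure V) \<subseteq> (\<Union>i\<in>J. ball (x i) (\<rho> i))
        \<and> (\<forall>i\<in>J. \<forall>js\<in>words N k. ratio js \<le> \<rho> i)"
      by (rule eventually_conj)
    then obtain k where cover_k: "iterate_image \<psi> N k (closure V) \<subseteq> (\<Union>i\<in>J. ball (x i) (\<rho> i))"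
      and small: "\<And>i js. i \<in> J \<Longrightarrow> js \<in> words N k \<Longrightarrow> ratio js \<le> \<rho> i"
      by (auto simp: eventually_sequentially)
    define B where "B i = {js \<in> words N k. compose_word \<psi> js v \<in> ball (x i) (\<rho> i)}" for i
    have "words N k \<subseteq> (\<Union>i\<in>J. B i)"
      using cover_k v closure_subset by (fastforce simp: B_def iterate_image_def)
    then have "mass t k \<le> (\<Sum>i\<in>J. \<Sum>js\<in>B i. ratio js powr t)"
      unfolding mass_def using J finite_words by (intro sum_le_sum_over_cover) (auto simp: B_def)
    then have "c * mass t k \<le> (\<Sum>i\<in>J. c * (\<Sum>js\<in>B i. ratio js powr t))"
      using c by (simp flip: sum_distrib_left)
    also have "\<dots> \<le> (\<Sum>i\<in>J. C * \<rho> i powr t * mass t k)"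
      unfolding B_def using \<rho> small by (intro sum_mono ball_bound) auto
    also have "\<dots> = C * (\<Sum>i\<in>J. \<rho> i powr t) * mass t k"
      by (simp add: sum_distrib_left sum_distrib_right mult_ac)
    finally have "c \<le> C * (\<Sum>i\<in>J. \<rho> i powr t)"
      using mass_pos[of t k] by simp
    then show "c / C \<le> (\<Sum>i\<in>J. \<rho> i powr t)"
      using C by (simp add: field_simps)
  qed (use c C in simp)
qed

text \<open>
  Arbitrary covering sets are enlarged to open balls at an arbitrarily small cost in the sum of the
  \<open>t\<close>-th powers, after which compactness leaves finitely many balls. The enlargement relies on the
  continuity of \<open>x powr t\<close> at \<open>x = 0\<close>, so the exponent \<open>t = 0\<close>, where the sum counts the non-empty
  sets of the cover, is treated on its own.
\<close>
lemma hausdorff_measure_nonzero_if_mass_bounded_below: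
  assumes E: "statistically_self_similar_set \<psi> N E"
    and t: "0 \<le> t" and c: "0 < c" "\<And>l. c \<le> mass t l"
  shows "hausdorff_measure t E \<noteq> 0"
proof
  assume zero: "hausdorff_measure t E = 0"
  have E': "compact E" "E \<noteq> {}"
    using E by (auto simp: statistically_self_similar_set_def)
  have "hausdorff_premeasure t 1 E \<le> hausdorff_measure t E"
    unfolding hausdorff_measure_def by (intro SUP_upper) auto
  then have pre: "hausdorff_premeasure t 1 E < ennreal e" if "e > 0" for e
    using zero that by simp
  have cheap_cover: "\<exists>U :: nat \<Rightarrow> 'a set. E \<subseteq> (\<Union>i. U i) \<and> (\<forall>i. bounded (U i)) \<and>
      (\<Sum>i. diameter_pow t (U i)) < ennreal e" if "e > 0" for e
    using pre[OF that] unfolding hausdorff_premeasure_def by (auto simp: INF_less_iff)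
  show False
  proof (cases "t = 0")
    case True
    obtain U :: "nat \<Rightarrow> 'a set" where U: "E \<subseteq> (\<Union>i. U i)" "(\<Sum>i. diameter_pow t (U i)) < ennreal 1"
      using cheap_cover[of 1] by auto
    obtain i where "U i \<noteq> {}" using U(1) E'(2) by blast
    then have "1 = (\<Sum>i\<in>{i}. diameter_pow t (U i))"
      using True by (simp add: diameter_pow_def)
    also have "\<dots> \<le> (\<Sum>i. diameter_pow t (U i))"
      by (rule sum_le_suminf) auto
    finally show False using U(2) by simp
  next
    case False
    with t have "t > 0" by simp
    obtain \<kappa> where \<kappa>: "\<kappa> > 0" and ball_cover:
      "\<And>J x \<rho>. finite (J :: nat set) \<Longrightarrow> (\<And>i. i \<in> J \<Longrightarrow> 0 < \<rho> i \<and> \<rho> i \<le> 1) \<Longrightarrow>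
       E \<subseteq> (\<Union>i\<in>J. ball (x i) (\<rho> i)) \<Longrightarrow> \<kappa> \<le> (\<Sum>i\<in>J. \<rho> i powr t)"
      using finite_ball_cover_bound[OF E t c] by blast
    \<comment> \<open>A cover of cost below \<open>e\<close>, enlarged at a further cost of at most \<open>e\<close>, contradicts the bound \<open>\<kappa>\<close>; that \<open>2 * e \<le> 1\<close> forces all radii to be at most 1.\<close>
    define e where "e = min \<kappa> 1 / 2"
    have e: "e > 0" "2 * e \<le> \<kappa>" "2 * e \<le> 1"
      using \<kappa> by (auto simp: e_def)
    obtain U :: "nat \<Rightarrow> 'a set" where U: "E \<subseteq> (\<Union>i. U i)" "\<And>i. bounded (U i)"
        "(\<Sum>i. diameter_pow t (U i)) < ennreal e"
      using cheap_cover[OF e(1)] by auto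
    define d where "d i = diameter (U i)" for i
    have d_nonneg: "0 \<le> d i" for i
      using diameter_ge_0[OF U(2)] by (simp add: d_def)
    have "\<exists>\<rho>>d i. \<rho> powr t < d i powr t + e * (1 / 2) ^ Suc i" for i
    proof -
      have "((\<lambda>x. x powr t) \<longlongrightarrow> d i powr t) (at_right (d i))"
        using \<open>t > 0\<close> d_nonneg[of i]
        by (intro tendsto_powr') (auto simp: eventually_at_right_less intro!: tendsto_intros
            eventually_mono[OF eventually_at_right_less])
      then have "\<forall>\<^sub>F x in at_right (d i). x powr t < d i powr t + e * (1 / 2) ^ Suc i"
        using e(1) by (intro order_tendstoD) auto
      then have "\<forall>\<^sub>F x in at_right (d i). x > d i \<and> x powr t < d i powr t + e * (1 / 2) ^ Suc i"
        by (intro eventually_conj eventually_at_right_less)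
      then show ?thesis
        using eventually_happens'[of "at_right (d i)"] trivial_limit_at_right_real by blast
    qed
    then obtain \<rho> where \<rho>: "d i < \<rho> i" "\<rho> i powr t < d i powr t + e * (1 / 2) ^ Suc i" for i
      by metis
    have sum_d: "(\<Sum>i\<in>J. d i powr t) < e" if "finite J" for J
    proof -
      have "ennreal (\<Sum>i\<in>J. d i powr t) = (\<Sum>i\<in>J. diameter_pow t (U i))"
        using \<open>t > 0\<close> by (simp add: diameter_pow_pos_exponent d_def flip: sum_ennreal)
      also have "\<dots> \<le> (\<Sum>i. diameter_pow t (U i))"
        using that by (intro sum_le_suminf) auto
      finally have "ennreal (\<Sum>i\<in>J. d i powr t) < ennreal e"
        using U(3) by simp
      then show ?thesis
        by (simp add: ennreal_less_iff sum_nonneg)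
    qed
    have sum_\<rho>: "(\<Sum>i\<in>J. \<rho> i powr t) < 2 * e" if "finite J" for J
    proof -
      have "(\<Sum>i\<in>J. \<rho> i powr t) \<le> (\<Sum>i\<in>J. d i powr t + e * (1 / 2) ^ Suc i)"
        using \<rho>(2) by (intro sum_mono less_imp_le)
      also have "\<dots> = (\<Sum>i\<in>J. d i powr t) + e * (\<Sum>i\<in>J. (1 / 2) ^ Suc i)"
        by (simp add: sum.distrib sum_distrib_left)
      also have "(\<Sum>i\<in>J. (1 / 2) ^ Suc i) \<le> (\<Sum>i. (1 / 2 :: real) ^ Suc i)"
        using that power_half_series by (intro sum_le_suminf) (auto simp: sums_iff)
      also have "(\<Sum>i. (1 / 2 :: real) ^ Suc i) = 1"
        using power_half_series by (simp add: sums_iff)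
      finally show ?thesis
        using sum_d[OF that] e(1) by simp
    qed
    \<comment> \<open>For empty \<open>U i\<close> the centre is arbitrary; an additional ball does no harm.\<close>
    define x where "x i = (SOME y. y \<in> U i)" for i
    have U_ball: "U i \<subseteq> ball (x i) (\<rho> i)" for i
    proof
      fix y assume "y \<in> U i"
      then have "x i \<in> U i"
        unfolding x_def by (rule someI)
      then have "dist (x i) y \<le> d i"
        unfolding d_def using U(2) \<open>y \<in> U i\<close> by (intro diameter_bounded_bound)
      with \<rho>(1)[of i] show "y \<in> ball (x i) (\<rho> i)" by simp
    qed
    have "E \<subseteq> (\<Union>i\<in>UNIV. ball (x i) (\<rho> i))"
      using U(1) U_ball by blast
    then obtain J where J: "finite J" "E \<subseteq> (\<Union>i\<in>J. ball (x i) (\<rho> i))"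
      using compactE_image[OF \<open>compact E\<close>, of UNIV "\<lambda>i. ball (x i) (\<rho> i)"] by (metis open_ball)
    have \<rho>_bounds: "0 < \<rho> i \<and> \<rho> i \<le> 1" for i
    proof
      show "0 < \<rho> i" using \<rho>(1)[of i] d_nonneg[of i] by simp
      have "\<rho> i powr t < 1"
        using sum_\<rho>[of "{i}"] e(3) by simp
      show "\<rho> i \<le> 1"
      proof (rule ccontr)
        assume "\<not> \<rho> i \<le> 1"
        then have "1 \<le> \<rho> i powr t"
          using t by (intro ge_one_powr_ge_zero) auto
        with \<open>\<rho> i powr t < 1\<close> show False by simp
      qed
    qed
    have "\<kappa> \<le> (\<Sum>i\<in>J. \<rho> i powr t)"
      using J \<rho>_bounds by (intro ball_cover[of J \<rho> x]) auto
    with sum_\<rho>[OF J(1)] e(2) show False by simp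
  qed
qed

section \<open>The critical exponent is the dimension\<close>

lemma mass_bounded_below:
  assumes "liminf (\<lambda>k. ereal (mass t k)) = \<infinity>"
  obtains c where "c > 0" "\<And>l. c \<le> mass t l"
proof -
  have "\<forall>\<^sub>F k in sequentially. ereal 1 < ereal (mass t k)"
    using assms by (intro less_LiminfD) simp
  then obtain K where K: "\<And>k. k \<ge> K \<Longrightarrow> 1 < mass t k"
    by (auto simp: eventually_sequentially)
  \<comment> \<open>The finitely many initial values, where only positivity is known, are included in the minimum.\<close>
  define c where "c = Min (insert 1 (mass t ` {..<K}))"
  have "c > 0" using mass_pos by (auto simp: c_def)
  moreover have "c \<le> mass t l" for l
  proof (cases "l < K")
    case True
    then show ?thesis unfolding c_def by (intro Min_le) auto
  next
    case False
    then have "c \<le> 1" "1 < mass t l" using K by (auto simp: c_def)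
    then show ?thesis by simp
  qed
  ultimately show thesis by (rule that)
qed

lemma mass_frequently_small:
  assumes "liminf (\<lambda>k. ereal (mass t k)) = 0" "e > 0"
  shows "\<exists>\<^sub>F k in sequentially. mass t k < e"
proof (rule ccontr)
  assume "\<not> ?thesis"
  then have "\<forall>\<^sub>F k in sequentially. ereal e \<le> ereal (mass t k)"
    by (simp add: not_frequently not_less)
  then have "ereal e \<le> liminf (\<lambda>k. ereal (mass t k))"
    by (rule Liminf_bounded)
  with assms show False by simp
qed

theorem hausdorff_dimension_attractor:
  assumes E: "statistically_self_similar_set \<psi> N E" and "s \<ge> 0"
    and below: "\<And>t. 0 \<le> t \<Longrightarrow> t < s \<Longrightarrow> liminf (\<lambda>k. ereal (mass t k)) = \<infinity>"
    and above: "\<And>t. 0 \<le> t \<Longrightarrow> s < t \<Longrightarrow> liminf (\<lambda>k. ereal (mass t k)) = 0"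
  shows "hausdorff_dimension E = ereal s"
proof (rule antisym)
  let ?T = "{t. 0 \<le> t \<and> hausdorff_measure t E = 0}"
  show "hausdorff_dimension E \<le> ereal s"
  proof (rule ereal_le_epsilon2)
    fix e :: real assume "e > 0"
    then have "hausdorff_measure (s + e) E = 0"
      using \<open>s \<ge> 0\<close> above[of "s + e"] mass_frequently_small
      by (intro hausdorff_measure_zero_if_mass_small[OF E]) auto
    then show "hausdorff_dimension E \<le> ereal s + ereal e"
      unfolding hausdorff_dimension_def using \<open>e > 0\<close> \<open>s \<ge> 0\<close> by (intro INF_lower2[of "s + e"]) auto
  qed
  show "ereal s \<le> hausdorff_dimension E"
    unfolding hausdorff_dimension_def
  proof (rule INF_greatest)
    fix t assume "t \<in> ?T"
    then have t: "0 \<le> t" "hausdorff_measure t E = 0" by auto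
    show "ereal s \<le> ereal t"
    proof (rule ccontr)
      assume "\<not> ereal s \<le> ereal t"
      then have "t < s" by simp
      then obtain c where "c > 0" "\<And>l. c \<le> mass t l"
        using mass_bounded_below[OF below[OF t(1)]] by blast
      then show False
        using hausdorff_measure_nonzero_if_mass_bounded_below[OF E t(1)] t(2) by blast
    qed
  qed
qed

end

theorem theorem2:
  fixes \<psi> :: "nat \<Rightarrow> real ^ 'n \<Rightarrow> real ^ 'n"
    and r :: "nat \<Rightarrow> real"
    and m :: nat
    and N :: "nat \<Rightarrow> nat set"
    and E :: "(real ^ 'n) set"
    and s :: real
  assumes "\<And>j. j \<in> {1..m} \<Longrightarrow> similitude (\<psi> j) (r j)"
    and "open_set_condition m \<psi>"
    and "\<And>k. k \<ge> 1 \<Longrightarrow> N k \<noteq> {} \<and> N k \<subseteq> {1..m}"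
    and "statistically_self_similar_set \<psi> N E"
    and "s \<ge> 0"
    and "\<And>t. 0 \<le> t \<Longrightarrow> t < s \<Longrightarrow>
           liminf (\<lambda>k. ereal (\<Sum>js\<in>words N k. prod_list (map r js) powr t)) = \<infinity>"
    and "\<And>t. 0 \<le> t \<Longrightarrow> s < t \<Longrightarrow>
           liminf (\<lambda>k. ereal (\<Sum>js\<in>words N k. prod_list (map r js) powr t)) = 0"
  shows "hausdorff_dimension E = ereal s"
proof -
  obtain V where V: "V \<noteq> {}" "bounded V" "open V" "\<forall>j\<in>{1..m}. \<psi> j ` V \<subseteq> V"
      "\<forall>i\<in>{1..m}. \<forall>j\<in>{1..m}. i \<noteq> j \<longrightarrow> \<psi> j ` V \<inter> \<psi> i ` V = {}"
    using assms(2) unfolding open_set_condition_def by blast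
  interpret open_set_system \<psi> r m N V
    by unfold_locales (use assms(1,3) V in blast)+
  show ?thesis
    using hausdorff_dimension_attractor[OF assms(4,5)] assms(6,7) unfolding mass_def by blast
qed

end
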